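(* Let $0<m<L<\infty$ and let $r$ satisfy $1-\sqrt{\frac mL}\le r<1$. Then the three-parameter algorithm $\mathcal{A}=(\alpha,\beta,\eta)$ with $$\alpha=\frac{(1+r)(1-r)^2}{m},\qquad \beta=r\,\frac{L(1-r+2r^2)-m(1+r)}{(L-m)(3-r)},\qquad \eta=r\,\frac{L(1-r^2)-m(1+2r-r^2)}{(L-m)(3-r)(1-r^2)}$$ achieves $\mathrm{rate}(\mathcal{A},F_{m,L})=r$.
   Context: Points of $\mathbb{R}^d$ are written as row vectors in $\mathbb{R}^{1\times d}$, $\nabla f:\mathbb{R}^{1\times d}\to\mathbb{R}^{1\times d}$, and $\|\cdot\|$ is the Frobenius norm. Function class $F_{m,L}$: continuously differentiable $f:\mathbb{R}^d\to\mathbb{R}$ such that for all $x,y\in\mathbb{R}^d$, $f(y)\ge f(x)+\langle\nabla f(x),y-x\rangle+\frac m2\|y-x\|^2$ and $\|\nabla f(x)-\nabla f(y)\|\le L\|x-y\|$. $y^\star$ denotes the unique minimizer of $f$. Algorithms: $\mathcal{A}=(A,B,C)$ with $A\in\mathbb{R}^{n\times n}$, $B\in\mathbb{R}^{n\times1}$, $C\in\mathbb{R}^{1\times n}$ denotes the iteration $\xi^{t+1}=A\xi^t+B(u^t+w^t)$, $y^t=C\xi^t$, $u^t=\nabla f(y^t)$, where $\xi^t\in\mathbb{R}^{n\times d}$ is the state and $w^t\in\mathbb{R}^{1\times d}$ the noise. A fixed point $\xi^\star$ satisfies $\xi^\star=A\xi^\star$, $y^\star=C\xi^\star$. The three-parameter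 algorithm $(\alpha,\beta,\eta)$ is $x^{t+1}=x^t-\alpha\,g\bigl(x^t+\eta(x^t-x^{t-1})\bigr)+\beta(x^t-x^{t-1})$, where $g(x)=\nabla f(x)+w$ is the noisy gradient oracle ($w=w^t$ at iteration $t$); it is of the form $(A,B,C)$ with $n=2$, state $\xi^t=\begin{bmatrix}x^t\\ x^{t-1}\end{bmatrix}$, $A=\begin{bmatrix}1+\beta&-\beta\\ 1&0\end{bmatrix}$, $B=\begin{bmatrix}-\alpha\\ 0\end{bmatrix}$, $C=\begin{bmatrix}1+\eta&-\eta\end{bmatrix}$. Convergence rate (computed with $w^t=0$ for all $t$): for a function class $\mathcal{F}$, $$\mathrm{rate}(\mathcal{A},\mathcal{F})=\inf\Bigl\{r>0:\ \sup_{f\in\mathcal{F}}\sup_{\xi^0\in\mathbb{R}^{n\times d}}\sup_{t\ge0}\frac{\|\xi^t-\xi^\star\|}{r^t\|\xi^0-\xi^\star\|}<\infty\Bigr\}.$$ *)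

theory Defs
  imports "HOL-Analysis.Analysis"
begin

text \<open>
  Points of \<open>\<real>\<^sup>d\<close> are row vectors, of type \<open>real^'d^1\<close>, and an \<open>n \<times> d\<close> matrix has type
  \<open>real^'d^'n\<close>. The library norm (and inner product) on \<open>real^'d^'n\<close> is the Frobenius one.
\<close>

definition grad :: "('a::real_inner \<Rightarrow> real) \<Rightarrow> 'a \<Rightarrow> 'a" where
  "grad f x = (THE D. GDERIV f x :> D)"

definition F_class :: "real \<Rightarrow> real \<Rightarrow> (real^'d^1 \<Rightarrow> real) set" where
  "F_class m L = {f.
     (\<forall>x. f differentiable (at x)) \<and> continuous_on UNIV (grad f) \<and>
     (\<forall>x y. f y \<ge> f x + grad f x \<bullet> (y - x) + m / 2 * (norm (y - x))\<^sup>2 \<and>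
            norm (grad f x - grad f y) \<le> L * norm (x - y))}"

type_synonym 'n algorithm = "(real^'n^'n) \<times> (real^1^'n) \<times> (real^'n^1)"

text \<open>The state \<open>\<xi>\<^sup>t\<close> for noise sequence \<open>w\<close> and initial state \<open>\<xi>\<^sup>0\<close>.\<close>

fun state :: "'n::finite algorithm \<Rightarrow> (real^'d^1 \<Rightarrow> real) \<Rightarrow> (nat \<Rightarrow> real^'d^1) \<Rightarrow>
    real^'d^'n \<Rightarrow> nat \<Rightarrow> real^'d^'n" where
  "state (A, B, C) f w \<xi>0 0 = \<xi>0"
| "state (A, B, C) f w \<xi>0 (Suc t) =
     (let \<xi> = state (A, B, C) f w \<xi>0 t; y = C ** \<xi>; u = grad f y
      in A ** \<xi> + B ** (u + w t))"

definition minimizer :: "('a \<Rightarrow> real) \<Rightarrow> 'a" where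
  "minimizer f = (THE y. is_arg_min f (\<lambda>_. True) y)"

fun is_fixed_point :: "'n::finite algorithm \<Rightarrow> (real^'d^1 \<Rightarrow> real) \<Rightarrow> real^'d^'n \<Rightarrow> bool" where
  "is_fixed_point (A, B, C) f \<xi> \<longleftrightarrow> \<xi> = A ** \<xi> \<and> minimizer f = C ** \<xi>"

text \<open>Meaningful when the fixed point exists and is unique; for the three-parameter algorithms
  below this is lemma \<open>is_fixed_point_three_param\<close>.\<close>

definition fixed_point :: "'n::finite algorithm \<Rightarrow> (real^'d^1 \<Rightarrow> real) \<Rightarrow> real^'d^'n" where
  "fixed_point \<A> f = (THE \<xi>. is_fixed_point \<A> f \<xi>)"

text \<open>Suprema and infimum are taken in the extended reals, so that an unbounded quotient has
  supremum \<open>\<infinity>\<close> and the rate is \<open>\<infinity>\<close> if no \<open>r\<close> qualifies. The initial state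
  \<open>\<xi>\<^sup>0 = \<xi>\<^sup>\<star>\<close>, for which the quotient is \<open>0/0\<close>, is left out.\<close>

definition rate :: "'n::finite algorithm \<Rightarrow> (real^'d^1 \<Rightarrow> real) set \<Rightarrow> ereal" where
  "rate \<A> F = Inf {ereal r | r. r > 0 \<and>
     (SUP f\<in>F. SUP \<xi>0\<in>UNIV - {fixed_point \<A> f}. SUP t.
        ereal (norm (state \<A> f (\<lambda>_. 0) \<xi>0 t - fixed_point \<A> f) /
               (r ^ t * norm (\<xi>0 - fixed_point \<A> f)))) < \<infinity>}"

definition three_param :: "real \<Rightarrow> real \<Rightarrow> real \<Rightarrow> 2 algorithm" where
  "three_param \<alpha> \<beta> \<eta> =
     (vector [vector [1 + \<beta>, -\<beta>],
              vector [1, 0]],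
      vector [vector [-\<alpha>],
              vector [0]],
      vector [vector [1 + \<eta>, -\<eta>]])"

lemma is_fixed_point_three_param:
  "is_fixed_point (three_param \<alpha> \<beta> \<eta>) f \<xi> \<longleftrightarrow> \<xi> = (\<chi> i. minimizer f $ 1)"
  by (auto simp: three_param_def vec_eq_iff matrix_matrix_mult_def forall_2 sum_2 vector_2
      algebra_simps vector_def)

text \<open>The matrix form is the recursion
  \<open>x\<^sup>t\<^sup>+\<^sup>1 = x\<^sup>t - \<alpha> g(x\<^sup>t + \<eta> (x\<^sup>t - x\<^sup>t\<^sup>-\<^sup>1)) + \<beta> (x\<^sup>t - x\<^sup>t\<^sup>-\<^sup>1)\<close> with the noisy oracle \<open>g\<close>;
  here \<open>x t\<close> is the first row of \<open>\<xi>\<^sup>t\<close> and \<open>x' t\<close>, which is \<open>x\<^sup>t\<^sup>-\<^sup>1\<close>, the second.\<close>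

lemma state_three_param:
  fixes f :: "real^'d^1 \<Rightarrow> real" and \<xi>0 :: "real^'d^2" and \<alpha> \<beta> \<eta> :: real
    and w :: "nat \<Rightarrow> real^'d^1"
  defines "\<xi> \<equiv> state (three_param \<alpha> \<beta> \<eta>) f w \<xi>0"
  defines "x \<equiv> \<lambda>t. (\<chi> i. \<xi> t $ 1) :: real^'d^1"
  defines "x' \<equiv> \<lambda>t. (\<chi> i. \<xi> t $ 2) :: real^'d^1"
  shows "x (Suc t) = x t - \<alpha> *\<^sub>R (grad f (x t + \<eta> *\<^sub>R (x t - x' t)) + w t) + \<beta> *\<^sub>R (x t - x' t)"
    and "x' (Suc t) = x t"
proof -
  define A B C where "A = (vector [vector [1 + \<beta>, -\<beta>], vector [1, 0]] :: real^2^2)"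
    and "B = (vector [vector [-\<alpha>], vector [0]] :: real^1^2)"
    and "C = (vector [vector [1 + \<eta>, -\<eta>]] :: real^2^1)"
  note mat_simps = vec_eq_iff matrix_matrix_mult_def sum_2 forall_1 vector_def algebra_simps
  have y: "C ** \<xi> t = x t + \<eta> *\<^sub>R (x t - x' t)"
    unfolding x_def x'_def C_def by (simp add: mat_simps)
  have step: "\<xi> (Suc t) = A ** \<xi> t + B ** (grad f (C ** \<xi> t) + w t)"
    by (simp add: \<xi>_def three_param_def A_def B_def C_def Let_def)
  show "x (Suc t) = x t - \<alpha> *\<^sub>R (grad f (x t + \<eta> *\<^sub>R (x t - x' t)) + w t) + \<beta> *\<^sub>R (x t - x' t)"
    unfolding y[symmetric] unfolding x_def x'_def step A_def B_def by (simp add: mat_simps)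
  show "x' (Suc t) = x t"
    unfolding x_def x'_def step A_def B_def by (simp add: mat_simps)
qed

end

theory Submission
  imports Defs
begin

text \<open>
  Let \<open>h = f - f(y\<^sup>\<star>) - m/2 \<parallel>\<cdot> - y\<^sup>\<star>\<parallel>\<^sup>2\<close>, which is convex with \<open>(L - m)\<close>-Lipschitz gradient, and put
  \<open>s\<^sub>t = \<nabla>h(y\<^sub>t)\<close>. In terms of the input \<open>s\<close> the algorithm is a linear system with poles \<open>r\<close> and
  \<open>r\<^sup>2\<close>. The pole \<open>r\<^sup>2\<close> is cancelled by taking \<open>r\<^sup>2\<close> times the interpolation inequality of \<open>h\<close> at
  \<open>(y\<^sub>t, y\<^sub>t\<^sub>+\<^sub>1)\<close> plus \<open>1 - r\<^sup>2\<close> times the one at \<open>(y\<^sup>\<star>, y\<^sub>t\<^sub>+\<^sub>1)\<close>. What remains involves only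
  \<open>z\<^sub>t = (x\<^sub>t - y\<^sup>\<star>) - r\<^sup>2 (x\<^sub>t\<^sub>-\<^sub>1 - y\<^sup>\<star>)\<close>, for which \<open>z\<^sub>t\<^sub>+\<^sub>1 = r z\<^sub>t - \<alpha> s\<^sub>t\<close>, and shows that
  \<open>V\<^sub>t = h(y\<^sub>t) - \<parallel>s\<^sub>t\<parallel>\<^sup>2/(2(L - m)) + c \<parallel>z\<^sub>t\<^sub>+\<^sub>1\<parallel>\<^sup>2 + e \<parallel>s\<^sub>t\<parallel>\<^sup>2\<close> satisfies \<open>V\<^sub>t\<^sub>+\<^sub>1 \<le> r\<^sup>2 V\<^sub>t\<close>, with defect
  \<open>e \<parallel>s\<^sub>t\<^sub>+\<^sub>1 - r s\<^sub>t\<parallel>\<^sup>2\<close>; the condition \<open>e \<ge> 0\<close> is equivalent to \<open>r \<ge> 1 - \<surd>(m/L)\<close>. Hence \<open>z\<^sub>t\<close>, and with it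
  \<open>x\<^sub>t - y\<^sup>\<star>\<close>, is \<open>O(r\<^sup>t)\<close> uniformly over the class. No smaller rate is possible because on
  \<open>f = m/2 \<parallel>\<cdot>\<parallel>\<^sup>2\<close> the iteration matrix has the eigenvalue \<open>r\<close>.
\<close>

section \<open>Smooth strongly convex functions\<close>

locale smooth_strongly_convex =
  fixes f :: "'a::euclidean_space \<Rightarrow> real" and g :: "'a \<Rightarrow> 'a" and m L :: real
  assumes m_pos: "0 < m" and m_less_L: "m < L"
    and gderiv: "\<And>x. GDERIV f x :> g x"
    and strong_convexity: "\<And>x y. f x + g x \<bullet> (y - x) + m / 2 * (norm (y - x))\<^sup>2 \<le> f y"
    and lipschitz: "\<And>x y. norm (g x - g y) \<le> L * norm (x - y)"
begin

text \<open>Along the segment from \<open>x\<close> to \<open>y\<close>, Cauchy-Schwarz and the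
  Lipschitz bound make the derivative of \<open>f\<close> minus its quadratic upper model
  nonpositive.\<close>

lemma descent: "f y \<le> f x + g x \<bullet> (y - x) + L / 2 * (norm (y - x))\<^sup>2"
proof -
  define \<phi> where "\<phi> t = f (x + t *\<^sub>R (y - x)) - t * (g x \<bullet> (y - x)) - L / 2 * t\<^sup>2 * (norm (y - x))\<^sup>2"
    for t :: real
  define \<phi>' where "\<phi>' t = g (x + t *\<^sub>R (y - x)) \<bullet> (y - x) - g x \<bullet> (y - x) - L * t * (norm (y - x))\<^sup>2"
    for t :: real
  have deriv: "(\<phi> has_real_derivative \<phi>' t) (at t)" for t
  proof -
    have "((\<lambda>t. x + t *\<^sub>R (y - x)) has_derivative (\<lambda>h. h *\<^sub>R (y - x))) (at t)"
      by (auto intro!: derivative_eq_intros)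
    then have "((\<lambda>t. f (x + t *\<^sub>R (y - x))) has_derivative
        (\<lambda>h. (h *\<^sub>R (y - x)) \<bullet> g (x + t *\<^sub>R (y - x)))) (at t)"
      by (rule has_derivative_compose[where g = f and g' = "\<lambda>h. h \<bullet> g (x + t *\<^sub>R (y - x))"])
        (use gderiv in \<open>simp add: gderiv_def\<close>)
    then have [derivative_intros]: "((\<lambda>t. f (x + t *\<^sub>R (y - x))) has_real_derivative
        g (x + t *\<^sub>R (y - x)) \<bullet> (y - x)) (at t)"
      by (simp add: has_field_derivative_def inner_commute mult_commute_abs)
    show ?thesis
      unfolding \<phi>_def \<phi>'_def by (auto intro!: derivative_eq_intros)
  qed
  have nonpos: "\<phi>' t \<le> 0" if "0 \<le> t" for t
  proof -
    have "(g (x + t *\<^sub>R (y - x)) - g x) \<bullet> (y - x) \<le> norm (g (x + t *\<^sub>R (y - x)) - g x) * norm (y - x)"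
      by (rule norm_cauchy_schwarz)
    also have "\<dots> \<le> (L * norm (x + t *\<^sub>R (y - x) - x)) * norm (y - x)"
      by (intro mult_right_mono lipschitz) auto
    also have "\<dots> = L * t * (norm (y - x))\<^sup>2"
      using that by (simp add: power2_eq_square)
    finally show ?thesis by (simp add: \<phi>'_def inner_diff_left)
  qed
  have "\<phi> 1 \<le> \<phi> 0"
    by (rule DERIV_nonpos_imp_nonincreasing) (use deriv nonpos in auto)
  then show ?thesis by (simp add: \<phi>_def)
qed

text \<open>A minimum over a compact ball is global here: strong convexity at 0 forces
  \<open>f 0 \<le> f y\<close> once \<open>norm y\<close> exceeds the radius
  \<open>2 * norm (g 0) / m\<close>.\<close>

lemma obtain_critical_point:
  obtains xs where "g xs = 0"
proof -
  define R where "R = 2 * norm (g 0) / m"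
  have R: "R \<ge> 0" using m_pos by (simp add: R_def)
  have cont: "continuous_on (cball 0 R) f"
    using gderiv
    by (intro continuous_at_imp_continuous_on) (auto simp: gderiv_def dest: has_derivative_continuous)
  obtain xs where xs: "\<And>y. y \<in> cball 0 R \<Longrightarrow> f xs \<le> f y"
    using continuous_attains_inf[OF compact_cball _ cont] R
    by (metis centre_in_cball empty_iff)
  have min: "f xs \<le> f y" for y
  proof (cases "y \<in> cball 0 R")
    case False
    then have "2 * norm (g 0) < m * norm y"
      using m_pos by (simp add: R_def field_simps)
    then have "norm y * (2 * norm (g 0)) \<le> norm y * (m * norm y)"
      by (intro mult_left_mono) auto
    moreover have "- (norm (g 0) * norm y) \<le> g 0 \<bullet> y"
      using Cauchy_Schwarz_ineq2[of "g 0" y] by linarith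
    ultimately have "f 0 \<le> f y"
      using strong_convexity[of 0 y] by (simp add: power2_eq_square algebra_simps)
    with xs[of 0] R show ?thesis by simp
  qed (use xs in auto)
  have "(\<lambda>h. h \<bullet> g xs) = (\<lambda>h. 0)"
    using differential_zero_maxmin[of xs UNIV f "\<lambda>h. h \<bullet> g xs"] gderiv[of xs] min
    by (auto simp: gderiv_def)
  then have "g xs \<bullet> g xs = 0" by meson
  then have "g xs = 0" by simp
  then show ?thesis by (rule that)
qed

text \<open>Strong convexity at a critical point gives quadratic growth, so the description in
  \<open>minimizer\<close> has exactly one solution.\<close>

lemma minimizer_eq:
  assumes "g xs = 0"
  shows "minimizer f = xs"
  unfolding minimizer_def
proof (rule the_equality)
  have strong: "f xs + m / 2 * (norm (y - xs))\<^sup>2 \<le> f y" for y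
    using strong_convexity[of xs y] assms by simp
  have "f xs \<le> f y" for y
    using strong[of y] m_pos by (smt (verit) divide_pos_pos mult_nonneg_nonneg zero_le_power2)
  then show "is_arg_min f (\<lambda>_. True) xs"
    by (auto simp: is_arg_min_def not_less)
  fix y assume "is_arg_min f (\<lambda>_. True) y"
  then have "f y \<le> f xs" by (auto simp: is_arg_min_def not_less)
  with strong[of y] have "m / 2 * (norm (y - xs))\<^sup>2 \<le> 0" by simp
  with m_pos show "y = xs" by (simp add: mult_le_0_iff)
qed

text \<open>The function h of the overview, with \<open>xs\<close> in the role of the minimizer;
  \<open>cvx_grad\<close> is its gradient. Both vanish at \<open>xs\<close> when
  \<open>g xs = 0\<close>.\<close>

definition cvx :: "'a \<Rightarrow> 'a \<Rightarrow> real" where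
  "cvx xs y = f y - f xs - m / 2 * (norm (y - xs))\<^sup>2"

definition cvx_grad :: "'a \<Rightarrow> 'a \<Rightarrow> 'a" where
  "cvx_grad xs y = g y - m *\<^sub>R (y - xs)"

text \<open>Convexity at \<open>b\<close> and the quadratic upper model at \<open>a\<close>, with
  constant \<open>L - m\<close>, are compared at one point \<open>v\<close>. It minimizes the upper
  model minus the lower one, which gains the squared gradient difference.\<close>

lemma interpolation:
  "cvx xs b + cvx_grad xs b \<bullet> (a - b) + (norm (cvx_grad xs a - cvx_grad xs b))\<^sup>2 / (2 * (L - m)) \<le> cvx xs a"
proof -
  define d where "d = cvx_grad xs a - cvx_grad xs b"
  define v where "v = a - (1 / (L - m)) *\<^sub>R d"
  have "cvx xs b + cvx_grad xs b \<bullet> (v - b) \<le> cvx xs v"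
    using strong_convexity[of b v] unfolding cvx_def cvx_grad_def power2_norm_eq_inner
    by (simp add: algebra_simps inner_commute)
  also have "cvx xs v \<le> cvx xs a + cvx_grad xs a \<bullet> (v - a) + (L - m) / 2 * (norm (v - a))\<^sup>2"
    using descent[of v a] unfolding cvx_def cvx_grad_def power2_norm_eq_inner
    by (simp add: algebra_simps inner_commute add_divide_distrib diff_divide_distrib)
  finally have "cvx xs b + cvx_grad xs b \<bullet> (a - b) + d \<bullet> (a - v)
      \<le> cvx xs a + (L - m) / 2 * (norm (v - a))\<^sup>2"
    by (simp add: d_def algebra_simps)
  moreover have "d \<bullet> (a - v) - (L - m) / 2 * (norm (v - a))\<^sup>2 = (norm d)\<^sup>2 / (2 * (L - m))"
  proof -
    define h where "h = 1 / (L - m)"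
    have h: "(L - m) * h = 1" using m_less_L by (simp add: h_def)
    have "d \<bullet> (a - v) - (L - m) / 2 * (norm (v - a))\<^sup>2
        = h * (norm d)\<^sup>2 - ((L - m) * h) * h / 2 * (norm d)\<^sup>2"
      unfolding v_def h_def[symmetric] power2_norm_eq_inner by simp
    also have "\<dots> = (h / 2) * (norm d)\<^sup>2" by (simp add: h)
    also have "h / 2 = 1 / (2 * (L - m))" unfolding h_def by (rule divide_divide_eq_left')
    finally show ?thesis by simp
  qed
  ultimately show ?thesis unfolding d_def by linarith
qed

lemma norm_cvx_grad_le:
  assumes "g xs = 0"
  shows "norm (cvx_grad xs y) \<le> (L + m) * norm (y - xs)"
proof -
  have "norm (cvx_grad xs y) \<le> norm (g y - g xs) + norm (m *\<^sub>R (y - xs))"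
    unfolding cvx_grad_def assms diff_zero by (rule norm_triangle_ineq4)
  then show ?thesis
    using lipschitz[of y xs] m_pos by (simp add: distrib_right)
qed

end


section \<open>The Lyapunov function\<close>

text \<open>Relative to the initial distance, \<open>G\<close> bounds \<open>s 0\<close>,
  \<open>K\<close> bounds \<open>V 0\<close> and \<open>sqrt (K / c)\<close> bounds z. No quantity
  depends on the function, so the bound is uniform over the class.\<close>

definition transient_factor :: "real \<Rightarrow> real \<Rightarrow> real \<Rightarrow> real \<Rightarrow> real \<Rightarrow> real \<Rightarrow> real \<Rightarrow> real" where
  "transient_factor m L r \<alpha> \<eta> a \<epsilon> =
     (let G = (L + m) * (1 + 2 * \<bar>\<eta>\<bar>);
          c = a / (2 * r * \<alpha>);
          K = G * (1 + 2 * \<bar>\<eta>\<bar>) + c * (2 + \<alpha> * G)\<^sup>2 + \<epsilon> / (2 * r) * G\<^sup>2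
      in 1 + sqrt (K / c) / (r * (1 - r)))"

text \<open>\<open>trace\<close> and \<open>det\<close> place the eigenvalues of the iteration
  matrix for curvature \<open>m\<close> at \<open>r\<close> and \<open>r\<^sup>2\<close>.
  \<open>a\<close> and \<open>\<epsilon>\<close> are the coefficients in \<open>q_Suc_le\<close>,
  and \<open>balance\<close> turns the remainder in \<open>V_Suc_le\<close> into a square.\<close>

locale three_param_trajectory = smooth_strongly_convex f g m L
  for f :: "'a::euclidean_space \<Rightarrow> real" and g m L +
  fixes x x' :: "nat \<Rightarrow> 'a" and xs :: 'a and r \<alpha> \<beta> \<eta> a \<epsilon> :: real
  assumes critical: "g xs = 0"
    and x_Suc: "\<And>t. x (Suc t) = x t - \<alpha> *\<^sub>R g (x t + \<eta> *\<^sub>R (x t - x' t)) + \<beta> *\<^sub>R (x t - x' t)"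
    and x'_Suc: "\<And>t. x' (Suc t) = x t"
    and r_pos: "0 < r" and r_less_1: "r < 1" and \<alpha>_pos: "0 < \<alpha>"
    and trace: "1 + \<beta> - \<alpha> * m * (1 + \<eta>) = r + r\<^sup>2"
    and det: "\<beta> - \<alpha> * m * \<eta> = r ^ 3"
    and a_eq: "a = 1 + \<eta> - \<eta> / r" and a_pos: "0 < a"
    and \<epsilon>_eq: "\<epsilon> = r\<^sup>2 / (L - m) - \<eta> * \<alpha> / r" and \<epsilon>_nonneg: "0 \<le> \<epsilon>"
    and balance: "1 / (L - m) - \<alpha> * a / (2 * r) = \<epsilon> / r"
begin

section \<open>Trajectory quantities and their one-step relations\<close>

definition y :: "nat \<Rightarrow> 'a" where "y t = x t + \<eta> *\<^sub>R (x t - x' t)"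

definition s :: "nat \<Rightarrow> 'a" where "s t = cvx_grad xs (y t)"

definition z :: "nat \<Rightarrow> 'a" where "z t = (x t - xs) - r\<^sup>2 *\<^sub>R (x' t - xs)"

text \<open>For critical \<open>xs\<close> this is the slack of \<open>interpolation\<close> between
  the base point \<open>xs\<close> and \<open>y t\<close>.\<close>

definition q :: "nat \<Rightarrow> real" where "q t = cvx xs (y t) - (norm (s t))\<^sup>2 / (2 * (L - m))"

definition V :: "nat \<Rightarrow> real" where
  "V t = q t + a / (2 * r * \<alpha>) * (norm (z (Suc t)))\<^sup>2 + \<epsilon> / (2 * r) * (norm (s t))\<^sup>2"

text \<open>The row (1, -r^2) is a left eigenvector, for the eigenvalue \<open>r\<close>, of the
  iteration matrix that remains when g is split into \<open>cvx_grad\<close> and its linear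
  part.\<close>

lemma z_Suc: "z (Suc t) = r *\<^sub>R z t - \<alpha> *\<^sub>R s t"
proof -
  define X X' where "X = x t - xs" and "X' = x' t - xs"
  have y: "y t - xs = X + \<eta> *\<^sub>R (X - X')"
    by (simp add: y_def X_def X'_def algebra_simps)
  have "x (Suc t) - xs = X - \<alpha> *\<^sub>R (s t + m *\<^sub>R (y t - xs)) + \<beta> *\<^sub>R (X - X')"
    by (simp add: x_Suc s_def cvx_grad_def y_def X_def X'_def algebra_simps)
  also have "\<dots> = (1 + \<beta> - \<alpha> * m * (1 + \<eta>)) *\<^sub>R X - (\<beta> - \<alpha> * m * \<eta>) *\<^sub>R X' - \<alpha> *\<^sub>R s t"
    unfolding y by (simp add: algebra_simps)
  finally have "z (Suc t) = (r + r\<^sup>2) *\<^sub>R X - r ^ 3 *\<^sub>R X' - \<alpha> *\<^sub>R s t - r\<^sup>2 *\<^sub>R X"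
    unfolding trace det by (simp add: z_def x'_Suc X_def)
  then show ?thesis
    by (simp add: z_def X_def X'_def algebra_simps power2_eq_square power3_eq_cube)
qed

text \<open>Subtracting \<open>r\<^sup>2\<close> times the previous output turns states into z at
  two consecutive times; \<open>z_Suc\<close> is then solved for the earlier one.\<close>

lemma y_Suc_diff:
  "(y (Suc t) - xs) - r\<^sup>2 *\<^sub>R (y t - xs) = a *\<^sub>R z (Suc t) - (\<eta> * \<alpha> / r) *\<^sub>R s t"
proof -
  have "(y (Suc t) - xs) - r\<^sup>2 *\<^sub>R (y t - xs) = (1 + \<eta>) *\<^sub>R z (Suc t) - \<eta> *\<^sub>R z t"
    by (simp add: y_def z_def x'_Suc algebra_simps)
  also have "z t = (1 / r) *\<^sub>R (z (Suc t) + \<alpha> *\<^sub>R s t)"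
    using r_pos by (simp add: z_Suc)
  finally show ?thesis by (simp add: a_eq algebra_simps)
qed

lemma divide_twice_gap: "w / (2 * (L - m)) = (w / (L - m)) / 2"
  by simp

lemma q_nonneg: "0 \<le> q t"
  using interpolation[of xs xs "y t"]
  by (simp add: q_def s_def cvx_def cvx_grad_def critical norm_minus_commute)

text \<open>This is \<open>interpolation\<close> with base point \<open>y t\<close>, evaluated at
  \<open>xs\<close>.\<close>

lemma q_le: "q t + (norm (s t))\<^sup>2 / (L - m) \<le> s t \<bullet> (y t - xs)"
proof -
  have "cvx xs (y t) + s t \<bullet> (xs - y t) + (norm (s t))\<^sup>2 / (2 * (L - m)) \<le> 0"
    using interpolation[of xs "y t" xs]
    by (simp add: s_def cvx_def cvx_grad_def critical norm_minus_commute)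
  moreover define w where "w = (norm (s t))\<^sup>2 / (L - m)"
  ultimately show ?thesis unfolding q_def divide_twice_gap w_def[symmetric] inner_diff_right by linarith
qed

text \<open>The weights \<open>r\<^sup>2\<close> and \<open>1 - r\<^sup>2\<close> sum to one on
  \<open>q (Suc t)\<close>, and they make the outputs enter only through the difference in
  \<open>y_Suc_diff\<close>.\<close>

lemma q_Suc_le: "q (Suc t) \<le> r\<^sup>2 * q t +
    s (Suc t) \<bullet> (a *\<^sub>R z (Suc t) + \<epsilon> *\<^sub>R s t - (1 / (L - m)) *\<^sub>R s (Suc t))"
proof -
  define S S' where "S = s (Suc t)" and "S' = s t"
  define h where "h = 1 / (L - m)"
  have "q (Suc t) + S \<bullet> (y t - y (Suc t)) + h * (S \<bullet> S - S \<bullet> S') \<le> q t"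
  proof -
    have "cvx xs (y (Suc t)) + S \<bullet> (y t - y (Suc t)) + (norm (S' - S))\<^sup>2 / (2 * (L - m)) \<le> cvx xs (y t)"
      unfolding S_def S'_def s_def by (rule interpolation)
    moreover have h: "w / (2 * (L - m)) = h * w / 2" for w by (simp add: h_def)
    ultimately show ?thesis
      unfolding q_def S_def[symmetric] S'_def[symmetric] power2_norm_eq_inner h
      by (simp add: algebra_simps inner_commute add_divide_distrib diff_divide_distrib)
  qed
  then have "r\<^sup>2 * (q (Suc t) + S \<bullet> (y t - y (Suc t)) + h * (S \<bullet> S - S \<bullet> S')) \<le> r\<^sup>2 * q t"
    by (rule mult_left_mono) simp
  moreover have "(1 - r\<^sup>2) * (q (Suc t) + h * (S \<bullet> S)) \<le> (1 - r\<^sup>2) * (S \<bullet> (y (Suc t) - xs))"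
    using q_le[of "Suc t"] r_pos r_less_1
    by (intro mult_left_mono) (auto simp: S_def h_def power2_norm_eq_inner power_le_one)
  ultimately have "q (Suc t) \<le> r\<^sup>2 * q t
      + S \<bullet> ((y (Suc t) - xs) - r\<^sup>2 *\<^sub>R (y t - xs)) + h * (r\<^sup>2 * (S \<bullet> S')) - h * (S \<bullet> S)"
    by (simp add: algebra_simps)
  then show ?thesis
    unfolding y_Suc_diff S_def[symmetric] S'_def[symmetric] \<epsilon>_eq h_def
    by (simp add: algebra_simps)
qed

lemma V_Suc_le: "V (Suc t) \<le> r\<^sup>2 * V t"
proof -
  define S S' Z where "S = s (Suc t)" and "S' = s t" and "Z = z (Suc t)"
  define c e where "c = a / (2 * r * \<alpha>)" and "e = \<epsilon> / (2 * r)"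
  have a: "a = 2 * r * \<alpha> * c" and \<epsilon>: "\<epsilon> = 2 * r * e"
    using r_pos \<alpha>_pos by (simp_all add: c_def e_def)
  have h: "1 / (L - m) = c * \<alpha>\<^sup>2 + 2 * e"
    using balance r_pos unfolding a \<epsilon> by (simp add: field_simps power2_eq_square)
  have "V (Suc t) \<le> r\<^sup>2 * q t + S \<bullet> (a *\<^sub>R Z + \<epsilon> *\<^sub>R S' - (1 / (L - m)) *\<^sub>R S)
      + c * (norm (r *\<^sub>R Z - \<alpha> *\<^sub>R S))\<^sup>2 + e * (norm S)\<^sup>2"
    using q_Suc_le[of t]
    by (simp add: V_def z_Suc[of "Suc t"] S_def S'_def Z_def c_def e_def)
  \<comment> \<open>The value of \<open>c\<close> cancels the product of \<open>S\<close> and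
    \<open>Z\<close>, \<open>\<epsilon> = 2 * r * e\<close> supplies the cross term of the square,
    and \<open>balance\<close> leaves the coefficient \<open>-e\<close> on the square of
    \<open>S\<close>.\<close>
  also have "\<dots> = r\<^sup>2 * (q t + c * (norm Z)\<^sup>2 + e * (norm S')\<^sup>2) - e * (norm (S - r *\<^sub>R S'))\<^sup>2"
    unfolding h a \<epsilon> power2_norm_eq_inner
    by (simp add: algebra_simps inner_commute power2_eq_square)
  also have "\<dots> \<le> r\<^sup>2 * (q t + c * (norm Z)\<^sup>2 + e * (norm S')\<^sup>2)"
    using \<epsilon>_nonneg r_pos by (simp add: e_def)
  finally show ?thesis by (simp add: V_def S'_def Z_def c_def e_def)
qed

section \<open>From decay of the Lyapunov function to decay of the state\<close>

lemma V_le: "V t \<le> (r ^ t)\<^sup>2 * V 0"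
proof (induction t)
  case (Suc t)
  have "V (Suc t) \<le> r\<^sup>2 * V t" by (rule V_Suc_le)
  also have "\<dots> \<le> r\<^sup>2 * ((r ^ t)\<^sup>2 * V 0)" using Suc by (rule mult_left_mono) simp
  finally show ?case by (simp add: power_mult_distrib)
qed simp

text \<open>\<open>V\<close> dominates the square of z because its other terms are nonnegative. The
  state is recovered from
  \<open>x (Suc t) - xs = r\<^sup>2 *\<^sub>R (x t - xs) + z (Suc t)\<close>, whose own factor
  \<open>r\<^sup>2\<close> is smaller than \<open>r\<close>.\<close>

lemma norm_x_le:
  "norm (x t - xs) \<le> transient_factor m L r \<alpha> \<eta> a \<epsilon> * r ^ t * (norm (x 0 - xs) + norm (x' 0 - xs))"
proof -
  define N where "N = norm (x 0 - xs) + norm (x' 0 - xs)"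
  define G where "G = (L + m) * (1 + 2 * \<bar>\<eta>\<bar>)"
  define c where "c = a / (2 * r * \<alpha>)"
  define K where "K = G * (1 + 2 * \<bar>\<eta>\<bar>) + c * (2 + \<alpha> * G)\<^sup>2 + \<epsilon> / (2 * r) * G\<^sup>2"
  define D where "D = 1 + sqrt (K / c) / (r * (1 - r))"
  have D: "transient_factor m L r \<alpha> \<eta> a \<epsilon> = D"
    unfolding transient_factor_def D_def K_def c_def G_def Let_def ..
  have N: "N \<ge> 0" by (simp add: N_def)
  have G: "G \<ge> 0" using m_pos m_less_L by (simp add: G_def)
  have c: "c > 0" using a_pos r_pos \<alpha>_pos by (simp add: c_def)
  have K: "K \<ge> 0" using G c \<epsilon>_nonneg r_pos by (simp add: K_def)
  have y0: "norm (y 0 - xs) \<le> (1 + 2 * \<bar>\<eta>\<bar>) * N"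
  proof -
    have "y 0 - xs = (x 0 - xs) + \<eta> *\<^sub>R ((x 0 - xs) - (x' 0 - xs))"
      by (simp add: y_def)
    then have "norm (y 0 - xs) \<le> norm (x 0 - xs) + \<bar>\<eta>\<bar> * norm ((x 0 - xs) - (x' 0 - xs))"
      by (metis norm_triangle_ineq norm_scaleR)
    also have "\<dots> \<le> N + \<bar>\<eta>\<bar> * N"
      unfolding N_def by (intro add_mono mult_left_mono norm_triangle_ineq4) auto
    also have "\<dots> \<le> (1 + 2 * \<bar>\<eta>\<bar>) * N" using N by (simp add: algebra_simps)
    finally show ?thesis .
  qed
  have s0: "norm (s 0) \<le> G * N"
  proof -
    have "norm (s 0) \<le> (L + m) * norm (y 0 - xs)"
      unfolding s_def using critical by (rule norm_cvx_grad_le)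
    also have "\<dots> \<le> (L + m) * ((1 + 2 * \<bar>\<eta>\<bar>) * N)"
      using y0 m_pos m_less_L by (intro mult_left_mono) auto
    finally show ?thesis by (simp add: G_def mult.assoc)
  qed
  have q0: "q 0 \<le> G * (1 + 2 * \<bar>\<eta>\<bar>) * N\<^sup>2"
  proof -
    have "0 \<le> (norm (s 0))\<^sup>2 / (L - m)" using m_less_L by simp
    then have "q 0 \<le> s 0 \<bullet> (y 0 - xs)" using q_le[of 0] by linarith
    also have "\<dots> \<le> norm (s 0) * norm (y 0 - xs)" by (rule norm_cauchy_schwarz)
    also have "\<dots> \<le> (G * N) * ((1 + 2 * \<bar>\<eta>\<bar>) * N)"
      using s0 y0 G N by (intro mult_mono) auto
    finally show ?thesis by (simp add: power2_eq_square algebra_simps)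
  qed
  \<comment> \<open>\<open>V 0\<close> contains \<open>z 1\<close>, not \<open>z 0\<close>, so one
    step of \<open>z_Suc\<close> is needed.\<close>
  have z1: "norm (z 1) \<le> (2 + \<alpha> * G) * N"
  proof -
    have r2: "r\<^sup>2 \<le> 1" using r_pos r_less_1 by (simp add: power_le_one)
    have "norm (z 0) \<le> norm (x 0 - xs) + r\<^sup>2 * norm (x' 0 - xs)"
      unfolding z_def using norm_triangle_ineq4[of "x 0 - xs" "r\<^sup>2 *\<^sub>R (x' 0 - xs)"] by simp
    also have "\<dots> \<le> N" unfolding N_def using r2 by (simp add: mult_left_le_one_le)
    finally have z0: "norm (z 0) \<le> N" .
    have "norm (z 1) \<le> r * norm (z 0) + \<alpha> * norm (s 0)"
      using norm_triangle_ineq4[of "r *\<^sub>R z 0" "\<alpha> *\<^sub>R s 0"] r_pos \<alpha>_pos by (simp add: z_Suc)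
    also have "\<dots> \<le> 1 * N + \<alpha> * (G * N)"
      using s0 z0 r_pos r_less_1 \<alpha>_pos N by (intro add_mono mult_mono) auto
    also have "\<dots> \<le> (2 + \<alpha> * G) * N" using N by (simp add: algebra_simps)
    finally show ?thesis .
  qed
  have V0: "V 0 \<le> K * N\<^sup>2"
  proof -
    have "(norm (z 1))\<^sup>2 \<le> (2 + \<alpha> * G)\<^sup>2 * N\<^sup>2" "(norm (s 0))\<^sup>2 \<le> G\<^sup>2 * N\<^sup>2"
      using power_mono[OF z1, of 2] power_mono[OF s0, of 2] by (simp_all add: power_mult_distrib)
    then have "V 0 \<le> G * (1 + 2 * \<bar>\<eta>\<bar>) * N\<^sup>2 + c * ((2 + \<alpha> * G)\<^sup>2 * N\<^sup>2)
        + \<epsilon> / (2 * r) * (G\<^sup>2 * N\<^sup>2)"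
      unfolding V_def c_def[symmetric] One_nat_def[symmetric]
      using q0 c \<epsilon>_nonneg r_pos by (intro add_mono mult_left_mono) auto
    then show ?thesis by (simp add: K_def algebra_simps)
  qed
  have z_le: "norm (z (Suc t)) \<le> sqrt (K / c) * r ^ t * N" for t
  proof -
    have "c * (norm (z (Suc t)))\<^sup>2 \<le> V t"
      using q_nonneg[of t] \<epsilon>_nonneg r_pos by (simp add: V_def c_def)
    also have "\<dots> \<le> (r ^ t)\<^sup>2 * (K * N\<^sup>2)"
      using V_le[of t] mult_left_mono[OF V0, of "(r ^ t)\<^sup>2"] by simp
    finally have "(norm (z (Suc t)))\<^sup>2 \<le> K / c * (r ^ t * N)\<^sup>2"
      using c by (simp add: field_simps power_mult_distrib)
    then have "norm (z (Suc t)) \<le> sqrt (K / c * (r ^ t * N)\<^sup>2)"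
      by (rule real_le_rsqrt)
    also have "\<dots> = sqrt (K / c) * (r ^ t * N)"
      unfolding real_sqrt_mult using r_pos N by simp
    finally show ?thesis by (simp add: mult.assoc)
  qed
  have "norm (x t - xs) \<le> D * r ^ t * N"
  proof (induction t)
    case 0
    have "0 \<le> sqrt (K / c) / (r * (1 - r))"
      using K c r_pos r_less_1 by (intro divide_nonneg_nonneg) auto
    then have "1 * N \<le> D * N" using N by (intro mult_right_mono) (auto simp: D_def)
    moreover have "norm (x 0 - xs) \<le> N" by (simp add: N_def)
    ultimately show ?case by simp
  next
    case (Suc t)
    have "x (Suc t) - xs = r\<^sup>2 *\<^sub>R (x t - xs) + z (Suc t)"
      by (simp add: z_def x'_Suc)
    then have "norm (x (Suc t) - xs) \<le> r\<^sup>2 * norm (x t - xs) + norm (z (Suc t))"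
      by (metis norm_triangle_ineq norm_scaleR abs_of_nonneg zero_le_power2)
    also have "\<dots> \<le> r\<^sup>2 * (D * r ^ t * N) + sqrt (K / c) * r ^ t * N"
      using Suc z_le[of t] by (intro add_mono mult_left_mono) auto
    also have "\<dots> = (r\<^sup>2 * D + sqrt (K / c)) * (r ^ t * N)"
      by (simp add: algebra_simps)
    \<comment> \<open>\<open>D - 1\<close> is chosen so that
      \<open>r\<^sup>2 * D + sqrt (K / c)\<close> equals \<open>r * D - r * (1 - r)\<close>.\<close>
    also have "\<dots> \<le> (r * D) * (r ^ t * N)"
    proof (rule mult_right_mono)
      have "sqrt (K / c) = (D - 1) * (r * (1 - r))"
        using r_pos r_less_1 by (simp add: D_def)
      moreover have "0 \<le> r * (1 - r)" using r_pos r_less_1 by simp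
      ultimately show "r\<^sup>2 * D + sqrt (K / c) \<le> r * D"
        by (simp add: algebra_simps power2_eq_square)
    qed (use r_pos N in auto)
    finally show ?case by (simp add: algebra_simps)
  qed
  then show ?thesis by (simp add: D N_def)
qed

end


section \<open>The function class and the parameters\<close>

text \<open>The derivative is a linear functional, hence the inner product with
  \<open>adjoint f' 1\<close>; uniqueness of derivatives makes the description in
  \<open>grad\<close> meaningful.\<close>

lemma gderiv_grad:
  fixes f :: "'a::euclidean_space \<Rightarrow> real"
  assumes "f differentiable (at x)"
  shows "GDERIV f x :> grad f x"
proof -
  obtain f' where f': "(f has_derivative f') (at x)"
    using assms by (auto simp: differentiable_def)
  then have "linear f'" by (rule has_derivative_linear)
  then have "f' = (\<lambda>h. h \<bullet> adjoint f' 1)"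
    by (simp add: adjoint_works fun_eq_iff)
  with f' have G: "GDERIV f x :> adjoint f' 1" by (simp add: gderiv_def)
  show ?thesis
    unfolding grad_def
  proof (rule theI[where P = "\<lambda>D. GDERIV f x :> D"])
    show "GDERIV f x :> adjoint f' 1" by (rule G)
    fix D assume "GDERIV f x :> D"
    with G have "(\<lambda>h. h \<bullet> D) = (\<lambda>h. h \<bullet> adjoint f' 1)"
      unfolding gderiv_def by (rule has_derivative_unique[rotated])
    then show "D = adjoint f' 1"
      by (metis inner_eq_zero_iff inner_diff_right right_minus_eq)
  qed
qed

lemma grad_eqI:
  fixes f :: "'a::euclidean_space \<Rightarrow> real"
  assumes "GDERIV f x :> D"
  shows "grad f x = D"
proof -
  have "f differentiable (at x)" using assms by (auto simp: gderiv_def differentiable_def)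
  then have "GDERIV f x :> grad f x" by (rule gderiv_grad)
  with assms have "(\<lambda>h. h \<bullet> grad f x) = (\<lambda>h. h \<bullet> D)"
    unfolding gderiv_def by (rule has_derivative_unique[rotated])
  then show ?thesis
    by (metis inner_eq_zero_iff inner_diff_right right_minus_eq)
qed

lemma F_class_smooth_strongly_convex:
  assumes "f \<in> F_class m L" "0 < m" "m < L"
  shows "smooth_strongly_convex f (grad f) m L"
  using assms by unfold_locales (auto simp: F_class_def intro: gderiv_grad)

text \<open>The extremal function for the lower bound: its strong convexity inequality is an
  equality.\<close>

lemma half_norm_squared_F_class:
  fixes m L :: real
  assumes "0 < m" "m < L"
  defines "f \<equiv> \<lambda>x::real^'d^1. m / 2 * (norm x)\<^sup>2"
  shows "f \<in> F_class m L" "grad f x = m *\<^sub>R x"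
proof -
  have G: "GDERIV f x :> m *\<^sub>R x" for x
    unfolding f_def power2_norm_eq_inner gderiv_def
    by (auto intro!: derivative_eq_intros simp: inner_commute fun_eq_iff)
  then have grad: "grad f x = m *\<^sub>R x" for x by (rule grad_eqI)
  then show "grad f x = m *\<^sub>R x" .
  have "f differentiable (at x)" for x
    using G by (auto simp: gderiv_def differentiable_def)
  moreover have "continuous_on UNIV (grad f)"
    unfolding grad by (intro continuous_intros)
  moreover have "f y = f x + grad f x \<bullet> (y - x) + m / 2 * (norm (y - x))\<^sup>2" for x y
    unfolding grad unfolding f_def power2_norm_eq_inner
    by (simp add: algebra_simps inner_commute)
  moreover have "norm (grad f x - grad f y) \<le> L * norm (x - y)" for x y
    unfolding grad using assms(1,2) by (simp add: scaleR_diff_right[symmetric] mult_right_mono)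
  ultimately show "f \<in> F_class m L" by (simp add: F_class_def)
qed

section \<open>Fixed points, row norms and parameter identities\<close>

lemma fixed_point_three_param:
  "fixed_point (three_param \<alpha> \<beta> \<eta>) f = (\<chi> i. minimizer f $ 1)"
  unfolding fixed_point_def is_fixed_point_three_param by simp

lemma norm_row: "norm (v :: real^'d^1) = norm (v $ 1)"
  by (simp add: norm_vec_def[of v] L2_set_def)

lemma norm_two_rows_le: "norm (\<xi> :: 'a::real_normed_vector^2) \<le> norm (\<xi> $ 1) + norm (\<xi> $ 2)"
  using L2_set_le_sum[of UNIV "\<lambda>i. norm (\<xi> $ i)"] by (simp add: norm_vec_def sum_2)

lemma parameter_identities:
  fixes m L r \<alpha> \<beta> \<eta> :: real
  assumes "0 < m" and "m < L" and "0 < r"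
    and "1 - sqrt (m / L) \<le> r" and "r < 1"
    and \<alpha>: "\<alpha> = (1 + r) * (1 - r)\<^sup>2 / m"
    and \<beta>: "\<beta> = r * ((L * (1 - r + 2 * r\<^sup>2) - m * (1 + r)) / ((L - m) * (3 - r)))"
    and \<eta>: "\<eta> = r * ((L * (1 - r\<^sup>2) - m * (1 + 2 * r - r\<^sup>2)) / ((L - m) * (3 - r) * (1 - r\<^sup>2)))"
  shows "0 < \<alpha>"
    and "1 + \<beta> - \<alpha> * m * (1 + \<eta>) = r + r\<^sup>2"
    and "\<beta> - \<alpha> * m * \<eta> = r ^ 3"
    and "0 < 1 + \<eta> - \<eta> / r"
    and "0 \<le> r\<^sup>2 / (L - m) - \<eta> * \<alpha> / r"
    and "1 / (L - m) - \<alpha> * (1 + \<eta> - \<eta> / r) / (2 * r) = (r\<^sup>2 / (L - m) - \<eta> * \<alpha> / r) / r"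
proof -
  define \<sigma> N where "\<sigma> = L - m" and "N = L * (1 - r\<^sup>2) - m * (1 + 2 * r - r\<^sup>2)"
  \<comment> \<open>With \<open>k\<close> the common denominator is a factor, so the claims reduce
    to polynomial identities in \<open>L\<close>, \<open>m\<close>, \<open>r\<close> modulo
    \<open>\<sigma> * (3 - r) * k = 1\<close>.\<close>
  define k where "k = 1 / (\<sigma> * (3 - r))"
  have \<sigma>: "\<sigma> > 0" using assms by (simp add: \<sigma>_def)
  have k: "k > 0" using \<sigma> assms by (simp add: k_def)
  have \<sigma>k: "\<sigma> * (3 - r) * k = 1" using \<sigma> assms by (simp add: k_def)
  have inv_\<sigma>: "1 / \<sigma> = (3 - r) * k" using \<sigma> assms by (simp add: k_def)
  have r2: "1 - r\<^sup>2 = (1 - r) * (1 + r)" by (simp add: algebra_simps power2_eq_square)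
  have \<alpha>m: "\<alpha> * m = (1 + r) * (1 - r)\<^sup>2" using assms by simp
  show "0 < \<alpha>" using assms by simp
  have \<eta>': "\<eta> * ((1 - r) * (1 + r)) = r * N * k"
  proof -
    have "1 - r\<^sup>2 \<noteq> 0" using assms(3,5) by (simp add: r2)
    moreover have "\<eta> = r * N * k / (1 - r\<^sup>2)" by (simp add: \<eta> N_def k_def \<sigma>_def)
    ultimately show ?thesis by (simp add: r2[symmetric])
  qed
  have \<alpha>m\<eta>: "\<alpha> * m * \<eta> = (1 - r) * r * N * k"
  proof -
    have "\<alpha> * m * \<eta> = (1 - r) * (\<eta> * ((1 - r) * (1 + r)))"
      unfolding \<alpha>m by (simp add: power2_eq_square algebra_simps)
    then show ?thesis unfolding \<eta>' by simp
  qed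
  show det: "\<beta> - \<alpha> * m * \<eta> = r ^ 3"
  proof -
    have "\<beta> = r * (L * (1 - r + 2 * r\<^sup>2) - m * (1 + r)) * k"
      by (simp add: \<beta> k_def \<sigma>_def)
    then have "\<beta> - \<alpha> * m * \<eta> = r ^ 3 * (\<sigma> * (3 - r) * k)"
      unfolding \<alpha>m\<eta> N_def \<sigma>_def by algebra
    then show ?thesis unfolding \<sigma>k by simp
  qed
  \<comment> \<open>The characteristic polynomial takes the value \<open>\<alpha> * m\<close> at 1,
    and \<alpha> is chosen to make this \<open>(1 - r) * (1 - r\<^sup>2)\<close>.\<close>
  show "1 + \<beta> - \<alpha> * m * (1 + \<eta>) = r + r\<^sup>2"
    using det \<alpha>m by algebra
  define a where "a = 1 + \<eta> - \<eta> / r"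
  have a: "a * (1 + r) = 2 * (L * (1 + r) - m) * k"
  proof -
    have "\<eta> * (1 - r) * (1 + r) / r = N * k" using \<eta>' \<open>0 < r\<close> by (simp add: field_simps)
    moreover have "a * (1 + r) = (1 + r) - \<eta> * (1 - r) * (1 + r) / r"
      using \<open>0 < r\<close> by (simp add: a_def field_simps)
    ultimately have "a * (1 + r) = (1 + r) * (\<sigma> * (3 - r) * k) - N * k"
      unfolding \<sigma>k by simp
    then show ?thesis unfolding N_def \<sigma>_def by algebra
  qed
  have "0 < L * r" using assms(1-3) by (intro mult_pos_pos) auto
  then have "m < L * (1 + r)" using assms(2) by (simp add: distrib_left)
  then have "0 < a * (1 + r)" unfolding a using k by simp
  then show "0 < 1 + \<eta> - \<eta> / r"
    using \<open>0 < r\<close> unfolding a_def by (simp add: zero_less_mult_iff)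
  have \<eta>\<alpha>: "\<eta> * \<alpha> / r = (1 - r) * N * k / m"
    using \<alpha>m\<eta> assms(1,3) by (simp add: field_simps)
  \<comment> \<open>The expression equals
    \<open>(1 + r) * (m - L * (1 - r)\<^sup>2) * k / m\<close>, so its sign is exactly the lower
    bound on \<open>r\<close>.\<close>
  show "0 \<le> r\<^sup>2 / (L - m) - \<eta> * \<alpha> / r"
  proof -
    have "1 - r \<le> sqrt (m / L)" using assms by simp
    then have "(1 - r)\<^sup>2 \<le> (sqrt (m / L))\<^sup>2" using assms by (intro power_mono) auto
    then have "L * (1 - r)\<^sup>2 \<le> m" using assms by (simp add: field_simps)
    then have "0 \<le> (1 + r) * (m - L * (1 - r)\<^sup>2) * k / m" using assms k by simp
    also have "(1 + r) * (m - L * (1 - r)\<^sup>2) = r\<^sup>2 * (3 - r) * m - (1 - r) * N"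
      unfolding N_def by algebra
    also have "(r\<^sup>2 * (3 - r) * m - (1 - r) * N) * k / m = r\<^sup>2 * (1 / \<sigma>) - \<eta> * \<alpha> / r"
      unfolding inv_\<sigma> \<eta>\<alpha> using assms(1) by (simp add: field_simps)
    finally show ?thesis by (simp add: \<sigma>_def)
  qed
  show "1 / (L - m) - \<alpha> * (1 + \<eta> - \<eta> / r) / (2 * r) = (r\<^sup>2 / (L - m) - \<eta> * \<alpha> / r) / r"
  proof -
    define P where "P = L * (1 + r) - m"
    have "\<alpha> * a = (1 - r)\<^sup>2 * (a * (1 + r)) / m" by (simp add: \<alpha>)
    then have \<alpha>a: "\<alpha> * a / (2 * r) = (1 - r)\<^sup>2 * (L * (1 + r) - m) * k / (m * r)"
      unfolding a P_def[symmetric] by simp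
    \<comment> \<open>Both sides of the goal are multiples of \<open>k / (m * r)\<close>; this
      equates their numerators.\<close>
    have "(3 - r) * m * r - (1 - r)\<^sup>2 * (L * (1 + r) - m) = r\<^sup>2 * ((3 - r) * m) - (1 - r) * N"
      unfolding N_def by algebra
    then have "((3 - r) * m * r - (1 - r)\<^sup>2 * (L * (1 + r) - m)) * k / (m * r)
        = (r\<^sup>2 * ((3 - r) * m) - (1 - r) * N) * k / (m * r)" by simp
    moreover have "((3 - r) * m * r - (1 - r)\<^sup>2 * (L * (1 + r) - m)) * k / (m * r)
        = 1 / \<sigma> - \<alpha> * a / (2 * r)"
      unfolding inv_\<sigma> \<alpha>a using assms(1,3) by (simp add: field_simps)
    moreover have "(r\<^sup>2 * ((3 - r) * m) - (1 - r) * N) * k / (m * r)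
        = (r\<^sup>2 * (1 / \<sigma>) - \<eta> * \<alpha> / r) / r"
      unfolding inv_\<sigma> \<eta>\<alpha> using assms(1,3) by (simp add: field_simps)
    ultimately show ?thesis by (simp add: \<sigma>_def a_def)
  qed
qed

section \<open>The convergence rate\<close>

theorem theorem4p7:
  fixes m L r \<alpha> \<beta> \<eta> :: real
  assumes "0 < m" and "m < L"
    and "1 - sqrt (m / L) \<le> r" and "r < 1"
    and "\<alpha> = (1 + r) * (1 - r)\<^sup>2 / m"
    and "\<beta> = r * ((L * (1 - r + 2 * r\<^sup>2) - m * (1 + r)) / ((L - m) * (3 - r)))"
    and "\<eta> = r * ((L * (1 - r\<^sup>2) - m * (1 + 2 * r - r\<^sup>2)) / ((L - m) * (3 - r) * (1 - r\<^sup>2)))"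
  shows "rate (three_param \<alpha> \<beta> \<eta>) (F_class m L :: (real^'d^1 \<Rightarrow> real) set) = ereal r"
proof -
  let ?A = "three_param \<alpha> \<beta> \<eta>"
  let ?F = "F_class m L :: (real^'d^1 \<Rightarrow> real) set"
  define ratio where "ratio r' f \<xi>0 t =
      ereal (norm (state ?A f (\<lambda>_. 0) \<xi>0 t - fixed_point ?A f) / (r' ^ t * norm (\<xi>0 - fixed_point ?A f)))"
    for r' and f :: "real^'d^1 \<Rightarrow> real" and \<xi>0 :: "real^'d^2" and t
  define worst where
    "worst r' = (SUP f\<in>?F. SUP \<xi>0\<in>UNIV - {fixed_point ?A f}. SUP t. ratio r' f \<xi>0 t)" for r'
  have rate: "rate ?A ?F = Inf {ereal r' | r'. r' > 0 \<and> worst r' < \<infinity>}"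
    unfolding rate_def worst_def ratio_def ..
  have "sqrt (m / L) < 1" using assms(1,2) by simp
  then have r_pos: "0 < r" using assms(3) by linarith
  note ids = parameter_identities[OF assms(1,2) r_pos assms(3-)]
  define a \<epsilon> where "a = 1 + \<eta> - \<eta> / r" and "\<epsilon> = r\<^sup>2 / (L - m) - \<eta> * \<alpha> / r"
  define D where "D = transient_factor m L r \<alpha> \<eta> a \<epsilon>"

  \<comment> \<open>One constant serves all functions, initial states and times, so \<open>r\<close>
    itself qualifies in the infimum.\<close>
  have upper: "ratio r f \<xi>0 t \<le> ereal (2 * (D + D / r))"
    if f: "f \<in> ?F" and \<xi>0: "\<xi>0 \<noteq> fixed_point ?A f" for f \<xi>0 t
  proof -
    define xs where "xs = minimizer f"
    define \<xi> where "\<xi> = state ?A f (\<lambda>_. 0) \<xi>0"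
    define x x' where "x t = (\<chi> i. \<xi> t $ 1 :: real^'d^1)" and "x' t = (\<chi> i. \<xi> t $ 2 :: real^'d^1)" for t
    define n where "n = norm (\<xi>0 - fixed_point ?A f)"
    interpret smooth_strongly_convex f "grad f" m L
      using f assms(1,2) by (rule F_class_smooth_strongly_convex)
    have critical: "grad f xs = 0"
      using obtain_critical_point minimizer_eq unfolding xs_def by metis
    have step: "x (Suc t) = x t - \<alpha> *\<^sub>R grad f (x t + \<eta> *\<^sub>R (x t - x' t)) + \<beta> *\<^sub>R (x t - x' t)"
      "x' (Suc t) = x t" for t
      using state_three_param[of \<alpha> \<beta> \<eta> f "\<lambda>_. 0" \<xi>0 t]
      unfolding x_def x'_def \<xi>_def by simp_all
    interpret three_param_trajectory f "grad f" m L x x' xs r \<alpha> \<beta> \<eta> a \<epsilon>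
      using critical step r_pos assms(4) ids by unfold_locales (simp_all add: a_def \<epsilon>_def)
    have rows: "norm (\<xi> t $ 1 - fixed_point ?A f $ 1) = norm (x t - xs)"
      "norm (\<xi> t $ 2 - fixed_point ?A f $ 2) = norm (x' t - xs)" for t
      by (simp_all add: norm_row x_def x'_def xs_def fixed_point_three_param)
    define N where "N = norm (x 0 - xs) + norm (x' 0 - xs)"
    have n: "n > 0" using \<xi>0 by (simp add: n_def)
    have N: "0 \<le> N" "N \<le> 2 * n"
    proof -
      have \<xi>0_eq: "\<xi> 0 = \<xi>0" by (simp add: \<xi>_def three_param_def)
      have component: "norm ((\<xi>0 - fixed_point ?A f) $ i) \<le> norm (\<xi>0 - fixed_point ?A f)" for i
        by (rule Finite_Cartesian_Product.norm_nth_le)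
      have "norm (x 0 - xs) \<le> n" "norm (x' 0 - xs) \<le> n"
        unfolding rows[symmetric] n_def
        using component[of 1] component[of 2] by (simp_all add: \<xi>0_eq)
      then show "N \<le> 2 * n" by (simp add: N_def)
    qed (simp add: N_def)
    have x_le: "norm (x t - xs) \<le> D * r ^ t * N" for t
      unfolding D_def N_def by (rule norm_x_le)
    have D: "D \<ge> 1"
      using m_pos m_less_L \<alpha>_pos r_pos r_less_1 a_pos \<epsilon>_nonneg
      unfolding D_def transient_factor_def Let_def
      by (auto intro!: divide_nonneg_nonneg add_nonneg_nonneg mult_nonneg_nonneg)
    \<comment> \<open>The delay by one step costs a factor \<open>1 / r\<close>; at time 0 the bound
      holds because \<open>D / r\<close> is at least 1.\<close>
    have x'_le: "norm (x' t - xs) \<le> (D / r) * r ^ t * N"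
    proof (cases t)
      case 0
      have "1 * N \<le> (D / r) * N"
        using N D r_pos r_less_1 by (intro mult_right_mono) (auto simp: field_simps)
      moreover have "norm (x' 0 - xs) \<le> N" by (simp add: N_def)
      ultimately show ?thesis by (simp add: 0)
    next
      case (Suc k)
      then show ?thesis using x_le[of k] r_pos by (simp add: x'_Suc)
    qed
    have "norm (\<xi> t - fixed_point ?A f) \<le> norm (x t - xs) + norm (x' t - xs)"
      using norm_two_rows_le[of "\<xi> t - fixed_point ?A f"] by (simp add: rows)
    also have "\<dots> \<le> (D + D / r) * r ^ t * N"
      using add_mono[OF x_le[of t] x'_le] by (simp only: distrib_right)
    also have "\<dots> \<le> (D + D / r) * r ^ t * (2 * n)"
      using D r_pos N by (intro mult_left_mono) auto
    finally have "norm (\<xi> t - fixed_point ?A f) / (r ^ t * n) \<le> 2 * (D + D / r)"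
      using r_pos n by (simp add: pos_divide_le_eq mult_ac)
    then show ?thesis by (simp add: ratio_def \<xi>_def n_def)
  qed
  have "worst r \<le> ereal (2 * (D + D / r))"
    unfolding worst_def by (intro SUP_least upper) auto
  then have worst_r: "worst r < \<infinity>" by (rule order.strict_trans1) simp

  have lower: "r \<le> r'" if r': "r' > 0" "worst r' < \<infinity>" for r'
  proof (rule ccontr)
    assume "\<not> r \<le> r'"
    then have gt: "1 < r / r'" using r' by simp
    define f where "f = (\<lambda>x::real^'d^1. m / 2 * (norm x)\<^sup>2)"
    have f: "f \<in> ?F" and grad: "grad f x = m *\<^sub>R x" for x
      unfolding f_def using half_norm_squared_F_class[OF assms(1,2)] by auto
    interpret smooth_strongly_convex f "grad f" m L
      using f assms(1,2) by (rule F_class_smooth_strongly_convex)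
    have "minimizer f = 0" by (rule minimizer_eq) (simp add: grad)
    then have fixed: "fixed_point ?A f = 0"
      by (simp add: fixed_point_three_param vec_eq_iff)
    define v where "v = (1 :: real^'d)"
    \<comment> \<open>The rows are in the ratio (r, 1), an eigenvector of the companion matrix for
      the eigenvalue \<open>r\<close>. The trajectory is therefore exactly geometric, and its
      quotient \<open>(r / r') ^ t\<close> is unbounded for \<open>r' < r\<close>.\<close>
    define \<xi>0 where "\<xi>0 = (\<chi> i::2. if i = 1 then r *\<^sub>R v else v)"
    have \<xi>0: "\<xi>0 \<noteq> 0" by (auto simp: \<xi>0_def v_def vec_eq_iff forall_2)
    define \<xi> where "\<xi> = state ?A f (\<lambda>_. 0) \<xi>0"
    have "\<xi> t $ 1 = r ^ Suc t *\<^sub>R v \<and> \<xi> t $ 2 = r ^ t *\<^sub>R v" for t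
    proof (induction t)
      case 0
      show ?case by (simp add: \<xi>_def three_param_def \<xi>0_def)
    next
      case (Suc t)
      define X X' where "X = (\<chi> i. \<xi> t $ 1 :: real^'d^1)" and "X' = (\<chi> i. \<xi> t $ 2 :: real^'d^1)"
      have "(\<chi> i. \<xi> (Suc t) $ 1 :: real^'d^1)
          = X - \<alpha> *\<^sub>R grad f (X + \<eta> *\<^sub>R (X - X')) + \<beta> *\<^sub>R (X - X')"
        and X': "(\<chi> i. \<xi> (Suc t) $ 2 :: real^'d^1) = X"
        using state_three_param[of \<alpha> \<beta> \<eta> f "\<lambda>_. 0" \<xi>0 t]
        unfolding X_def X'_def \<xi>_def by simp_all
      then have "(\<chi> i. \<xi> (Suc t) $ 1 :: real^'d^1)
          = (1 + \<beta> - \<alpha> * m * (1 + \<eta>)) *\<^sub>R X - (\<beta> - \<alpha> * m * \<eta>) *\<^sub>R X'"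
        by (simp add: grad algebra_simps)
      then have "\<xi> (Suc t) $ 1 = (r + r\<^sup>2) *\<^sub>R \<xi> t $ 1 - r ^ 3 *\<^sub>R \<xi> t $ 2"
        unfolding ids by (simp add: vec_eq_iff X_def X'_def)
      moreover have "\<xi> (Suc t) $ 2 = \<xi> t $ 1"
        using X' by (simp add: vec_eq_iff X_def)
      ultimately show ?case
        using Suc by (simp add: scaleR_diff_left[symmetric] algebra_simps power2_eq_square power3_eq_cube)
    qed
    then have "\<xi> t = r ^ t *\<^sub>R \<xi>0" for t
      by (simp add: vec_eq_iff[where x = "\<xi> t"] forall_2 \<xi>0_def mult.commute)
    then have ratio: "ratio r' f \<xi>0 t = ereal ((r / r') ^ t)" for t
      using \<xi>0 r_pos unfolding ratio_def fixed \<xi>_def[symmetric] by (simp add: power_divide)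
    have "ratio r' f \<xi>0 t \<le> worst r'" for t
      unfolding worst_def using f \<xi>0
      by (intro SUP_upper2[where i = f] SUP_upper2[where i = \<xi>0] SUP_upper) (auto simp: fixed)
    moreover obtain B where "worst r' \<le> ereal B"
      using r'(2) by (cases "worst r'") auto
    ultimately have "(r / r') ^ t \<le> B" for t
      unfolding ratio by (meson ereal_less_eq(3) order_trans)
    moreover obtain t where "B < (r / r') ^ t"
      using real_arch_pow[OF gt] by blast
    ultimately show False by (meson not_less)
  qed

  show ?thesis
    unfolding rate
  proof (rule antisym)
    show "Inf {ereal r' | r'. r' > 0 \<and> worst r' < \<infinity>} \<le> ereal r"
      using worst_r r_pos by (intro Inf_lower) auto
    show "ereal r \<le> Inf {ereal r' | r'. r' > 0 \<and> worst r' < \<infinity>}"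
      using lower by (intro Inf_greatest) auto
  qed
qed

end
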